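(* Let $G$ be a totally disconnected locally compact group with a continuous and proper cocompact action by isometries on a geodesically complete proper CAT(0) space $X$. Then there is $\varepsilon>0$ such that for any elliptic $g\in G$ and any $x\in X$ with $gx\neq x$ we have $\angle_{c_{g,x}}(gx,x) \geq \varepsilon$.
   Context: A metric space is proper if all its closed balls are compact. A CAT(0) space is geodesically complete if every geodesic segment of positive length can be extended to a bi-infinite geodesic line. A group acts cocompactly on $X$ if the translates of some compact set cover $X$. An element $g$ is elliptic if it has a fixed point in $X$; for elliptic $g$ and $x\in X$, $c_{g,x}$ denotes the nearest point projection of $x$ to the closed convex set of $g$-fixed points. $\angle_p(x,y)$ is the Alexandrov angle at $p$ between the geodesic segments $[p,x]$ and $[p,y]$. *)

theory Defs
  imports "HOL-Analysis.Analysis" "HOL-Algebra.Group_Action"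
begin

subsection \<open>Geodesics and metric spaces\<close>

definition geodesic_between :: "(real \<Rightarrow> 'a::metric_space) \<Rightarrow> 'a \<Rightarrow> 'a \<Rightarrow> bool" where
  "geodesic_between c x y \<longleftrightarrow>
     c 0 = x \<and> c (dist x y) = y \<and>
     (\<forall>s\<in>{0..dist x y}. \<forall>t\<in>{0..dist x y}. dist (c s) (c t) = \<bar>s - t\<bar>)"

definition geodesic_segment :: "'a::metric_space \<Rightarrow> 'a \<Rightarrow> 'a set \<Rightarrow> bool" where
  "geodesic_segment x y S \<longleftrightarrow> (\<exists>c. geodesic_between c x y \<and> S = c ` {0..dist x y})"

definition geodesic_line :: "(real \<Rightarrow> 'a::metric_space) \<Rightarrow> bool" where
  "geodesic_line c \<longleftrightarrow> (\<forall>s t. dist (c s) (c t) = \<bar>s - t\<bar>)"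

text \<open>These properties concern a whole type, viewed as a metric space with underlying set
  \<^term>\<open>UNIV\<close>; the type is passed as an \<^typ>\<open>'a itself\<close> argument.\<close>

definition proper_metric_space :: "'a::metric_space itself \<Rightarrow> bool" where
  "proper_metric_space _ \<longleftrightarrow> (\<forall>(x::'a) r. compact (cball x r))"

definition geodesically_complete :: "'a::metric_space itself \<Rightarrow> bool" where
  "geodesically_complete _ \<longleftrightarrow>
     (\<forall>(c::real \<Rightarrow> 'a) x y. x \<noteq> y \<longrightarrow> geodesic_between c x y \<longrightarrow>
        (\<exists>L. geodesic_line L \<and> (\<forall>t\<in>{0..dist x y}. L t = c t)))"

text \<open>The CAT(0) condition compares a geodesic triangle with sides \<open>S1\<close>, \<open>S2\<close>, \<open>S3\<close> to a triangle
  in the Euclidean plane with the same side lengths. A point \<open>u\<close> of the side \<open>S\<close> from \<open>x\<close> to \<open>y\<close>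
  has as comparison point the point \<open>u'\<close> of the corresponding Euclidean side at the same distance
  from the first vertex.\<close>

definition comparison_point ::
  "'a::metric_space \<Rightarrow> 'a set \<Rightarrow> real^2 \<Rightarrow> real^2 \<Rightarrow> 'a \<Rightarrow> real^2 \<Rightarrow> bool" where
  "comparison_point x S x' y' u u' \<longleftrightarrow>
     u \<in> S \<and> u' \<in> closed_segment x' y' \<and> dist x' u' = dist x u"

definition CAT0 :: "'a::metric_space itself \<Rightarrow> bool" where
  "CAT0 _ \<longleftrightarrow>
     (\<forall>x y::'a. \<exists>S. geodesic_segment x y S) \<and>
     (\<forall>(x::'a) y z S1 S2 S3 (x'::real^2) y' z'.
        geodesic_segment x y S1 \<longrightarrow> geodesic_segment y z S2 \<longrightarrow> geodesic_segment z x S3 \<longrightarrow>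
        dist x' y' = dist x y \<longrightarrow> dist y' z' = dist y z \<longrightarrow> dist z' x' = dist z x \<longrightarrow>
        (let cmp = (\<lambda>u u'. comparison_point x S1 x' y' u u' \<or>
                           comparison_point y S2 y' z' u u' \<or>
                           comparison_point z S3 z' x' u u')
         in \<forall>u u' v v'. cmp u u' \<longrightarrow> cmp v v' \<longrightarrow> dist u v \<le> dist u' v'))"


subsection \<open>Alexandrov angles and projections\<close>

text \<open>The comparison angle is the angle at \<open>p\<close> of a Euclidean triangle with the side lengths of
  \<open>p, x, y\<close>, given by the law of cosines.\<close>

definition comparison_angle :: "'a::metric_space \<Rightarrow> 'a \<Rightarrow> 'a \<Rightarrow> real" where
  "comparison_angle p x y =
     arccos (((dist p x)\<^sup>2 + (dist p y)\<^sup>2 - (dist x y)\<^sup>2) / (2 * dist p x * dist p y))"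

lemma comparison_angle_eq_Euclidean_angle:
  fixes p x y :: "'a::metric_space" and p' x' y' :: "real^2"
  assumes "dist p' x' = dist p x" "dist p' y' = dist p y" "dist x' y' = dist x y"
  shows "comparison_angle p x y =
           arccos (((x' - p') \<bullet> (y' - p')) / (norm (x' - p') * norm (y' - p')))"
proof -
  have n: "dist p x = norm (x' - p')" "dist p y = norm (y' - p')"
    using assms by (auto simp: dist_norm norm_minus_commute)
  have "dist x y = norm ((x' - p') - (y' - p'))"
    using assms by (simp add: dist_norm)
  then have d: "(dist x y)\<^sup>2 = (norm (x' - p'))\<^sup>2 + (norm (y' - p'))\<^sup>2 - 2 * ((x' - p') \<bullet> (y' - p'))"
    using dot_norm_neg[of "x' - p'" "y' - p'"] by simp
  show ?thesis
    unfolding comparison_angle_def d unfolding n by simp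
qed

text \<open>The Alexandrov angle between two geodesics issuing from the same point is the limit superior
  of the comparison angles as both (positive) parameters tend to \<open>0\<close>. It is formed in
  \<^typ>\<open>ereal\<close> because \<^const>\<open>Limsup\<close> needs a complete lattice; as \<^const>\<open>arccos\<close> takes values in
  \<open>[0, pi]\<close> here, it is finite.\<close>

definition Alexandrov_angle_geodesics ::
  "(real \<Rightarrow> 'a::metric_space) \<Rightarrow> (real \<Rightarrow> 'a) \<Rightarrow> real" where
  "Alexandrov_angle_geodesics c c' =
     real_of_ereal (Limsup (at_right 0 \<times>\<^sub>F at_right 0)
       (\<lambda>(t, t'). ereal (comparison_angle (c 0) (c t) (c' t'))))"

text \<open>In a CAT(0) space the geodesic from \<open>p\<close> to \<open>x\<close> is unique on \<open>[0, dist p x]\<close>. For \<open>x \<noteq> p\<close> and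
  \<open>y \<noteq> p\<close> the angle below therefore does not depend on the choices made; for \<open>x = p\<close> or \<open>y = p\<close>
  it is meaningless.\<close>

definition Alexandrov_angle :: "'a::metric_space \<Rightarrow> 'a \<Rightarrow> 'a \<Rightarrow> real" where
  "Alexandrov_angle p x y =
     Alexandrov_angle_geodesics (SOME c. geodesic_between c p x) (SOME c. geodesic_between c p y)"

text \<open>The library's \<^const>\<open>closest_point\<close> is restricted to inner product spaces.\<close>

definition nearest_point :: "'a::metric_space set \<Rightarrow> 'a \<Rightarrow> 'a" where
  "nearest_point S x = (THE c. c \<in> S \<and> (\<forall>y\<in>S. dist x c \<le> dist x y))"

definition fixed_points :: "('a \<Rightarrow> 'a) \<Rightarrow> 'a set" where
  "fixed_points f = {x. f x = x}"

definition elliptic :: "('a \<Rightarrow> 'a) \<Rightarrow> bool" where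
  "elliptic f \<longleftrightarrow> fixed_points f \<noteq> {}"


subsection \<open>Topological groups and their actions\<close>

locale topological_group = group G for G :: "('g, 'r) monoid_scheme" (structure) +
  fixes T :: "'g topology"
  assumes topspace_eq: "topspace T = carrier G"
    and continuous_mult: "continuous_map (prod_topology T T) T (\<lambda>(g, h). g \<otimes> h)"
    and continuous_inv: "continuous_map T T (\<lambda>g. inv g)"

text \<open>As usual, locally compact groups are understood to be Hausdorff.\<close>

locale locally_compact_group = topological_group +
  assumes Hausdorff: "Hausdorff_space T"
    and locally_compact: "locally_compact_space T"

definition totally_disconnected_space :: "'a topology \<Rightarrow> bool" where
  "totally_disconnected_space T \<longleftrightarrow> (\<forall>S. connectedin T S \<longrightarrow> (\<exists>a. S \<subseteq> {a}))"

definition isometric_action :: "('g, 'r) monoid_scheme \<Rightarrow> ('g \<Rightarrow> 'x::metric_space \<Rightarrow> 'x) \<Rightarrow> bool" where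
  "isometric_action G \<phi> \<longleftrightarrow>
     group_action G UNIV \<phi> \<and> (\<forall>g\<in>carrier G. \<forall>x y. dist (\<phi> g x) (\<phi> g y) = dist x y)"

definition continuous_action :: "'g topology \<Rightarrow> ('g \<Rightarrow> 'x::metric_space \<Rightarrow> 'x) \<Rightarrow> bool" where
  "continuous_action T \<phi> \<longleftrightarrow>
     continuous_map (prod_topology T euclidean) euclidean (\<lambda>(g, x). \<phi> g x)"

text \<open>For a continuous action of a Hausdorff group the set below is automatically closed, so
  asking for compactness or for relative compactness amounts to the same.\<close>

definition proper_action ::
  "('g, 'r) monoid_scheme \<Rightarrow> 'g topology \<Rightarrow> ('g \<Rightarrow> 'x::metric_space \<Rightarrow> 'x) \<Rightarrow> bool" where
  "proper_action G T \<phi> \<longleftrightarrow>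
     (\<forall>K. compact K \<longrightarrow> compactin T {g \<in> carrier G. \<phi> g ` K \<inter> K \<noteq> {}})"

definition cocompact_action ::
  "('g, 'r) monoid_scheme \<Rightarrow> ('g \<Rightarrow> 'x::metric_space \<Rightarrow> 'x) \<Rightarrow> bool" where
  "cocompact_action G \<phi> \<longleftrightarrow> (\<exists>K. compact K \<and> (\<Union>g\<in>carrier G. \<phi> g ` K) = UNIV)"

end

theory Submission
  imports Defs
begin

text \<open>By van Dantzig's theorem, \<open>G\<close> has arbitrarily small open subgroups; the circumcenters of their
  orbits are fixed points, and geodesic completeness forces such a subgroup to fix a whole given
  ball pointwise. Hence, by properness and cocompactness, there is \<open>N\<close> such that near each of its
  fixed points \<open>c\<close> every elliptic \<open>g\<close> satisfies \<open>g\<^sup>n = 1\<close> for some \<open>1 \<le> n \<le> N\<close>. If now the angle at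
  \<open>c = c\<^bsub>g,x\<^esub>\<close> is less than \<open>1 / (N + 1)\<close>, then some \<open>z\<close> on \<open>[c, x]\<close> near \<open>c\<close> is moved by less
  than \<open>d(c, z) / (N + 1)\<close>, and so the circumcenter of the finite \<open>g\<close>-orbit of \<open>z\<close> is a fixed point
  at distance less than \<open>d(c, z)\<close> from \<open>z\<close>: it is closer to \<open>x\<close> than \<open>c\<close>.\<close>

subsection \<open>CAT(0) geometry\<close>

text \<open>With \<open>x\<close> at the origin and \<open>y\<close> on the first axis, the law of
  cosines gives the first coordinate \<open>u\<close> of the third vertex. The triangle inequality
  yields |u| \<le> b, so \<open>v\<close> is a genuine square root.\<close>

lemma comparison_triangle_exists:
  fixes x y z :: "'a::metric_space"
  obtains x' y' z' :: "real^2"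
  where "dist x' y' = dist x y" "dist y' z' = dist y z" "dist z' x' = dist z x"
proof (cases "x = y")
  case True
  have "dist (vector [0, 0]::real^2) (vector [dist x z, 0]) = dist x z"
    by (simp add: dist_vec_def L2_set_def sum_2)
  then show thesis
    using that[of "vector [0, 0]" "vector [0, 0]" "vector [dist x z, 0]"] True
    by (simp add: dist_commute)
next
  case False
  define a where "a = dist x y"
  define b where "b = dist x z"
  define c where "c = dist y z"
  define u where "u = (a\<^sup>2 + b\<^sup>2 - c\<^sup>2) / (2 * a)"
  define v where "v = sqrt (b\<^sup>2 - u\<^sup>2)"
  have pos: "a > 0" "b \<ge> 0" "c \<ge> 0"
    using False by (auto simp: a_def b_def c_def)
  have tri: "a \<le> b + c" "b \<le> a + c" "c \<le> a + b"
    unfolding a_def b_def c_def by metric+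
  have "(a - b)\<^sup>2 \<le> c\<^sup>2" "c\<^sup>2 \<le> (a + b)\<^sup>2"
    using tri pos by (auto simp: abs_le_square_iff[symmetric])
  then have "a\<^sup>2 + b\<^sup>2 - c\<^sup>2 \<le> b * (2 * a)" "- (b * (2 * a)) \<le> a\<^sup>2 + b\<^sup>2 - c\<^sup>2"
    by (simp_all add: power2_eq_square algebra_simps)
  then have "u \<le> b" "- b \<le> u"
    using pos unfolding u_def by (simp_all add: pos_divide_le_eq pos_le_divide_eq)
  then have "u\<^sup>2 \<le> b\<^sup>2"
    by (simp add: abs_le_square_iff[symmetric])
  then have v2: "v\<^sup>2 = b\<^sup>2 - u\<^sup>2"
    unfolding v_def by simp
  have ua: "2 * a * u = a\<^sup>2 + b\<^sup>2 - c\<^sup>2"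
    using pos unfolding u_def by simp
  have "(a - u)\<^sup>2 + v\<^sup>2 = c\<^sup>2"
    using v2 ua by (simp add: power2_eq_square algebra_simps)
  then have c: "sqrt ((a - u)\<^sup>2 + v\<^sup>2) = c"
    using pos by simp
  have b: "sqrt (u\<^sup>2 + v\<^sup>2) = b"
    using pos v2 by simp
  show thesis
  proof (rule that)
    show "dist (vector [0, 0]::real^2) (vector [a, 0]) = dist x y"
      using pos by (simp add: dist_vec_def L2_set_def sum_2 a_def)
    show "dist (vector [a, 0]::real^2) (vector [u, v]) = dist y z"
      using c by (simp add: dist_vec_def L2_set_def sum_2 c_def dist_real_def)
    show "dist (vector [u, v]::real^2) (vector [0, 0]) = dist z x"
      using b by (simp add: dist_vec_def L2_set_def sum_2 b_def dist_commute)
  qed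
qed

section \<open>Geodesics and consequences of comparison\<close>

lemma geodesic_between_reverse:
  assumes "geodesic_between c x y"
  shows "geodesic_between (\<lambda>t. c (dist x y - t)) y x"
  using assms by (auto simp: geodesic_between_def dist_commute[of y x] abs_minus_commute)

lemma geodesic_segment_commute:
  assumes "geodesic_segment x y S"
  shows "geodesic_segment y x S"
proof -
  obtain c where c: "geodesic_between c x y" "S = c ` {0..dist x y}"
    using assms by (auto simp: geodesic_segment_def)
  have "(\<lambda>t. c (dist x y - t)) ` {0..dist x y} = c ` {0..dist x y}"
  proof (intro equalityI image_subsetI)
    fix t assume "t \<in> {0..dist x y}"
    then show "c t \<in> (\<lambda>t. c (dist x y - t)) ` {0..dist x y}"
      by (intro image_eqI[where x = "dist x y - t"]) auto
  qed auto
  then show ?thesis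
    using geodesic_between_reverse[OF c(1)] c(2)
    by (auto simp: geodesic_segment_def dist_commute[of y x])
qed

lemma geodesic_between_dist:
  assumes "geodesic_between c x y" "t \<in> {0..dist x y}"
  shows "dist x (c t) = t" "dist (c t) y = dist x y - t"
proof -
  have "dist (c r) (c s) = \<bar>r - s\<bar>" if "r \<in> {0..dist x y}" "s \<in> {0..dist x y}" for r s
    using assms(1) that unfolding geodesic_between_def by blast
  from this[of 0 t] this[of t "dist x y"]
  have "dist (c 0) (c t) = t" "dist (c t) (c (dist x y)) = dist x y - t"
    using assms(2) by simp_all
  then show "dist x (c t) = t" "dist (c t) y = dist x y - t"
    using assms(1) unfolding geodesic_between_def by simp_all
qed

lemma geodesic_between_image:
  assumes "geodesic_between c x y" "\<And>u v. dist (f u) (f v) = dist u v"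
  shows "geodesic_between (f \<circ> c) (f x) (f y)"
  using assms by (auto simp: geodesic_between_def)

lemma CAT0_geodesic_segment_exists:
  assumes "CAT0 TYPE('a::metric_space)"
  obtains S where "geodesic_segment x (y::'a) S"
  using conjunct1[OF assms[unfolded CAT0_def]] by blast

lemma CAT0_geodesic_exists:
  assumes "CAT0 TYPE('a::metric_space)"
  obtains c where "geodesic_between c x (y::'a)"
  using CAT0_geodesic_segment_exists[OF assms, of x y] by (auto simp: geodesic_segment_def)

lemma CAT0_comparison:
  fixes x y z :: "'a::metric_space" and x' y' z' :: "real^2"
  assumes "CAT0 TYPE('a)"
    and "geodesic_segment x y S1" "geodesic_segment y z S2" "geodesic_segment z x S3"
    and "dist x' y' = dist x y" "dist y' z' = dist y z" "dist z' x' = dist z x"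
    and "comparison_point x S1 x' y' u u' \<or> comparison_point y S2 y' z' u u' \<or>
         comparison_point z S3 z' x' u u'"
    and "comparison_point x S1 x' y' v v' \<or> comparison_point y S2 y' z' v v' \<or>
         comparison_point z S3 z' x' v v'"
  shows "dist u v \<le> dist u' v'"
  using conjunct2[OF assms(1)[unfolded CAT0_def Let_def], rule_format, OF assms(2-9)] .

text \<open>The comparison points are the images of \<open>x'\<close> and \<open>y'\<close> under
  the homothety with centre \<open>p'\<close> and ratio \<open>l\<close>.\<close>

lemma CAT0_hinge:
  fixes p x y :: "'a::metric_space"
  assumes CAT0: "CAT0 TYPE('a)" and b: "geodesic_between b p x" and c: "geodesic_between c p y"
    and l: "0 \<le> l" "l \<le> 1"
  shows "dist (b (l * dist p x)) (c (l * dist p y)) \<le> l * dist x y"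
proof -
  obtain p' x' y' :: "real^2" where e:
    "dist p' x' = dist p x" "dist x' y' = dist x y" "dist y' p' = dist y p"
    by (rule comparison_triangle_exists)
  obtain S where S: "geodesic_segment x y S"
    by (rule CAT0_geodesic_segment_exists[OF CAT0])
  have Sb: "geodesic_segment p x (b ` {0..dist p x})"
    using b by (auto simp: geodesic_segment_def)
  have Sc: "geodesic_segment y p (c ` {0..dist p y})"
    by (rule geodesic_segment_commute) (use c in \<open>auto simp: geodesic_segment_def\<close>)
  have in_range: "l * dist p x \<in> {0..dist p x}" "l * dist p y \<in> {0..dist p y}"
    using l by (simp_all add: mult_left_le_one_le)
  define u where "u = p' + l *\<^sub>R (x' - p')"
  define v where "v = p' + l *\<^sub>R (y' - p')"
  have u: "comparison_point p (b ` {0..dist p x}) p' x' (b (l * dist p x)) u"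
  proof -
    have "u = (1 - l) *\<^sub>R p' + l *\<^sub>R x'"
      by (simp add: u_def algebra_simps)
    then have "u \<in> closed_segment p' x'"
      using l unfolding in_segment by blast
    moreover have "dist p' u = l * dist p x"
      using l e(1) by (simp add: u_def dist_norm norm_minus_commute)
    ultimately show ?thesis
      using in_range geodesic_between_dist(1)[OF b in_range(1)] by (auto simp: comparison_point_def)
  qed
  \<comment> \<open>\<open>c\<close> starts at \<open>p\<close>, but the third side of the
    comparison triangle starts at \<open>y\<close>, so the position of \<open>v\<close> is measured
    from \<open>y'\<close>.\<close>
  have v: "comparison_point y (c ` {0..dist p y}) y' p' (c (l * dist p y)) v"
  proof -
    have "v = (1 - l) *\<^sub>R p' + l *\<^sub>R y'"
      by (simp add: v_def algebra_simps)
    then have "v \<in> closed_segment p' y'"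
      using l unfolding in_segment by blast
    moreover have "dist y' v = dist p y - l * dist p y"
    proof -
      have "y' - v = (1 - l) *\<^sub>R (y' - p')"
        by (simp add: v_def algebra_simps)
        then have "dist y' v = (1 - l) * dist y' p'"
        using l by (simp only: dist_norm norm_scaleR abs_of_nonneg diff_ge_0_iff_ge)
      then show ?thesis
        by (simp add: e(3) dist_commute[of y p] algebra_simps)
    qed
    ultimately show ?thesis
      using in_range geodesic_between_dist(2)[OF c in_range(2)]
      by (auto simp: comparison_point_def closed_segment_commute dist_commute)
  qed
  have "dist (b (l * dist p x)) (c (l * dist p y)) \<le> dist u v"
    using CAT0_comparison[OF CAT0 Sb S Sc e] u v by blast
  also have "u - v = l *\<^sub>R (x' - y')"
    by (simp add: u_def v_def algebra_simps)
  then have "dist u v = l * dist x y"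
    using l e(2) by (simp add: dist_norm)
  finally show ?thesis .
qed

text \<open>This is a hinge whose two end points coincide: the bound \<open>l * dist x x\<close>
  vanishes.\<close>

lemma CAT0_geodesic_unique:
  fixes p x :: "'a::metric_space"
  assumes "CAT0 TYPE('a)" "geodesic_between b p x" "geodesic_between c p x" "t \<in> {0..dist p x}"
  shows "b t = c t"
proof (cases "p = x")
  case True
  then show ?thesis
    using assms by (auto simp: geodesic_between_def)
next
  case False
  then show ?thesis
    using CAT0_hinge[OF assms(1-3), of "t / dist p x"] assms(4) by simp
qed

text \<open>The comparison triangle satisfies the Euclidean median formula, and CAT(0) compares the
  medians. This strict convexity makes nearest points and circumcenters unique.\<close>

lemma CAT0_CN_inequality:
  fixes x y z :: "'a::metric_space"
  assumes CAT0: "CAT0 TYPE('a)" and c: "geodesic_between c x y"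
  shows "(dist z (c (dist x y / 2)))\<^sup>2 \<le> ((dist z x)\<^sup>2 + (dist z y)\<^sup>2) / 2 - (dist x y)\<^sup>2 / 4"
proof -
  obtain x' y' z' :: "real^2" where e:
    "dist x' y' = dist x y" "dist y' z' = dist y z" "dist z' x' = dist z x"
    by (rule comparison_triangle_exists)
  obtain S T where S: "geodesic_segment y z S" and T: "geodesic_segment z x T"
    using CAT0_geodesic_segment_exists[OF CAT0] by metis
  have Sc: "geodesic_segment x y (c ` {0..dist x y})"
    using c by (auto simp: geodesic_segment_def)
  have "comparison_point x (c ` {0..dist x y}) x' y' (c (dist x y / 2)) (midpoint x' y')"
    using geodesic_between_dist(1)[OF c, of "dist x y / 2"] e(1)
    by (auto simp: comparison_point_def dist_midpoint)
  moreover have "z \<in> T"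
    using T by (force simp: geodesic_segment_def geodesic_between_def)
  then have "comparison_point z T z' x' z z'"
    by (auto simp: comparison_point_def)
  ultimately have "dist z (c (dist x y / 2)) \<le> dist z' (midpoint x' y')"
    using CAT0_comparison[OF CAT0 Sc S T e] by blast
  then have "(dist z (c (dist x y / 2)))\<^sup>2 \<le> (dist z' (midpoint x' y'))\<^sup>2"
    by simp
  also have "z' - midpoint x' y' = ((z' - x') + (z' - y')) /\<^sub>R 2"
    by (simp add: midpoint_def vec_eq_iff field_simps)
  then have "(dist z' (midpoint x' y'))\<^sup>2 = (norm ((z' - x') + (z' - y')))\<^sup>2 / 4"
    by (simp add: dist_norm power_divide)
  also have "\<dots> = ((dist z' x')\<^sup>2 + (dist z' y')\<^sup>2) / 2 - (dist x' y')\<^sup>2 / 4"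
  proof -
    have "(norm (u + v))\<^sup>2 / 4 = ((norm u)\<^sup>2 + (norm v)\<^sup>2) / 2 - (norm (v - u))\<^sup>2 / 4" for u v :: "real^2"
      by (simp add: power2_norm_eq_inner inner_add inner_diff inner_commute field_simps)
    from this[of "z' - x'" "z' - y'"] show ?thesis
      by (simp add: dist_norm)
  qed
  finally show ?thesis
    using e by (simp add: dist_commute)
qed

text \<open>The image \<open>f \<circ> c\<close> is again a geodesic from \<open>x\<close> to
  \<open>y\<close>, hence agrees with \<open>c\<close>. Thus fixed point sets of isometries are
  convex.\<close>

lemma CAT0_geodesic_between_fixed_points:
  fixes f :: "'a::metric_space \<Rightarrow> 'a"
  assumes "CAT0 TYPE('a)" "\<And>u v. dist (f u) (f v) = dist u v"
    and "geodesic_between c x y" "f x = x" "f y = y" "t \<in> {0..dist x y}"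
  shows "f (c t) = c t"
  using CAT0_geodesic_unique[OF assms(1) _ assms(3,6), of "f \<circ> c"]
    geodesic_between_image[OF assms(3), of f] assms(2,4,5) by simp

section \<open>Nearest points and circumcenters\<close>

lemma proper_nearest_point_exists:
  fixes x :: "'a::metric_space"
  assumes proper: "proper_metric_space TYPE('a)" and S: "closed S" "S \<noteq> {}"
  obtains c where "c \<in> S" "\<forall>y\<in>S. dist x c \<le> dist x y"
proof -
  obtain s where s: "s \<in> S"
    using S by auto
  have "compact (cball x (dist x s) \<inter> S)"
    using proper S by (simp add: proper_metric_space_def compact_Int_closed)
  moreover have "cball x (dist x s) \<inter> S \<noteq> {}"
    using s by auto
  moreover have "continuous_on (cball x (dist x s) \<inter> S) (dist x)"
    by (intro continuous_intros)
  ultimately obtain c where c: "c \<in> cball x (dist x s) \<inter> S"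
      "\<forall>y\<in>cball x (dist x s) \<inter> S. dist x c \<le> dist x y"
    using continuous_attains_inf by blast
  then show thesis
    using that[of c] by force
qed

text \<open>By the CN inequality, the midpoint of two distinct nearest fixed points would be a fixed
  point strictly closer to \<open>x\<close>. So the \<open>THE\<close> in
  \<open>nearest_point\<close> is well defined.\<close>

lemma nearest_point_fixed_points:
  fixes f :: "'a::metric_space \<Rightarrow> 'a"
  assumes proper: "proper_metric_space TYPE('a)" and CAT0: "CAT0 TYPE('a)"
    and f: "\<And>u v. dist (f u) (f v) = dist u v" and "elliptic f"
  shows "f (nearest_point (fixed_points f) x) = nearest_point (fixed_points f) x"
    and "f y = y \<Longrightarrow> dist x (nearest_point (fixed_points f) x) \<le> dist x y"
proof -
  let ?P = "\<lambda>c. c \<in> fixed_points f \<and> (\<forall>y\<in>fixed_points f. dist x c \<le> dist x y)"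
  have "continuous_on UNIV f"
    using f by (auto simp: continuous_on_iff)
  then have "closed (fixed_points f)"
    unfolding fixed_points_def by (intro closed_Collect_eq) auto
  then obtain c where c: "?P c"
    using proper_nearest_point_exists[OF proper] assms(4) unfolding elliptic_def by metis
  have "d = c" if d: "?P d" for d
  proof (rule ccontr)
    assume "d \<noteq> c"
    obtain g where g: "geodesic_between g c d"
      by (rule CAT0_geodesic_exists[OF CAT0])
    have "f (g (dist c d / 2)) = g (dist c d / 2)"
      using c d by (intro CAT0_geodesic_between_fixed_points[OF CAT0 f g]) (auto simp: fixed_points_def)
    then have "dist x c \<le> dist x (g (dist c d / 2))"
      using c by (auto simp: fixed_points_def)
    then have "(dist x c)\<^sup>2 \<le> (dist x (g (dist c d / 2)))\<^sup>2"
      by simp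
    also have "\<dots> \<le> ((dist x c)\<^sup>2 + (dist x d)\<^sup>2) / 2 - (dist c d)\<^sup>2 / 4"
      by (rule CAT0_CN_inequality[OF CAT0 g])
    also have "dist x d = dist x c"
      using c d by (intro antisym) auto
    finally show False
      using \<open>d \<noteq> c\<close> by simp
  qed
  then have "?P (nearest_point (fixed_points f) x)"
    unfolding nearest_point_def using c theI[of ?P c] by blast
  then show "f (nearest_point (fixed_points f) x) = nearest_point (fixed_points f) x"
    and "f y = y \<Longrightarrow> dist x (nearest_point (fixed_points f) x) \<le> dist x y"
    by (auto simp: fixed_points_def)
qed

text \<open>The circumcenter is the unique minimizer of the radius function \<open>h\<close>. An
  isometry preserving \<open>S\<close> preserves \<open>h\<close>, hence fixes the
  minimizer.\<close>

lemma CAT0_circumcenter: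
  fixes z :: "'a::metric_space"
  assumes proper: "proper_metric_space TYPE('a)" and CAT0: "CAT0 TYPE('a)"
    and S: "z \<in> S" "S \<subseteq> cball z r"
  obtains q where "dist z q \<le> r"
    "\<And>f. (\<And>u v. dist (f u) (f v) = dist u v) \<Longrightarrow> f ` S = S \<Longrightarrow> f q = q"
proof -
  define h where "h y = (SUP s\<in>S. dist y s)" for y
  have bdd: "bdd_above (dist y ` S)" for y
  proof (rule bdd_aboveI2)
    fix s assume "s \<in> S"
    then have "dist z s \<le> r"
      using S by auto
    then show "dist y s \<le> dist y z + r"
      using dist_triangle[of y s z] by linarith
  qed
  have upper: "dist y s \<le> h y" if "s \<in> S" for y s
    unfolding h_def using bdd that by (rule cSUP_upper2) auto
  have least: "h y \<le> m" if "\<And>s. s \<in> S \<Longrightarrow> dist y s \<le> m" for y m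
    unfolding h_def using S that by (intro cSUP_least) auto
  have Lipschitz: "h y \<le> h y' + dist y y'" for y y'
  proof (rule least)
    fix s assume "s \<in> S"
    then show "dist y s \<le> h y' + dist y y'"
      using upper[of s y'] dist_triangle[of y s y'] by linarith
  qed
  have "dist (h y) (h y') \<le> dist y y'" for y y'
    using Lipschitz[of y y'] Lipschitz[of y' y] by (simp add: dist_real_def dist_commute abs_le_iff)
  then have "continuous_on (cball z r) h"
    by (intro lipschitz_on_continuous_on[of 1] lipschitz_onI) simp_all
  moreover have "compact (cball z r)" "cball z r \<noteq> {}"
    using proper S by (auto simp: proper_metric_space_def)
  ultimately obtain q where q: "q \<in> cball z r" "\<forall>y\<in>cball z r. h q \<le> h y"
    using continuous_attains_inf by blast
  \<comment> \<open>The minimum over the compact ball is global: outside the ball,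
    \<open>h y\<close> \<ge> \<open>dist y z\<close> \<ge> \<open>r\<close> \<ge>
    \<open>h z\<close>.\<close>
  have minimal: "h q \<le> h y" for y
  proof (cases "y \<in> cball z r")
    case False
    have "h q \<le> h z"
      using q S by auto
    also have "h z \<le> r"
      using S by (intro least) auto
    also have "r \<le> dist y z"
      using False by (simp add: dist_commute)
    also have "\<dots> \<le> h y"
      using S by (intro upper)
    finally show ?thesis .
  qed (use q in auto)
  have unique: "y = q" if "h y = h q" for y
  proof (rule ccontr)
    assume "y \<noteq> q"
    obtain g where g: "geodesic_between g q y"
      by (rule CAT0_geodesic_exists[OF CAT0])
    let ?m = "g (dist q y / 2)"
    \<comment> \<open>Halfway to a second minimizer, the CN inequality bounds the distances to all
      points of \<open>S\<close> by a radius below \<open>h q\<close>.\<close>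
    have "h ?m \<le> sqrt ((h q)\<^sup>2 - (dist q y)\<^sup>2 / 4)"
    proof (rule least)
      fix s assume "s \<in> S"
      then have "(dist s q)\<^sup>2 \<le> (h q)\<^sup>2" "(dist s y)\<^sup>2 \<le> (h q)\<^sup>2"
        using upper[of s q] upper[of s y] \<open>h y = h q\<close> by (auto simp: dist_commute intro!: power_mono)
      then have "(dist s ?m)\<^sup>2 \<le> (h q)\<^sup>2 - (dist q y)\<^sup>2 / 4"
        using CAT0_CN_inequality[OF CAT0 g, of s] by argo
      then show "dist ?m s \<le> sqrt ((h q)\<^sup>2 - (dist q y)\<^sup>2 / 4)"
        by (intro real_le_rsqrt) (simp add: dist_commute)
    qed
    also have "\<dots> < sqrt ((h q)\<^sup>2)"
      using \<open>y \<noteq> q\<close> by (intro real_sqrt_less_mono) simp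
    also have "\<dots> = h q"
      using order_trans[OF zero_le_dist upper[OF S(1)], of q] by simp
    finally show False
      using minimal[of ?m] by simp
  qed
  show thesis
  proof (rule that)
    show "dist z q \<le> r"
      using q by simp
    fix f :: "'a \<Rightarrow> 'a" assume f: "\<And>u v. dist (f u) (f v) = dist u v" and "f ` S = S"
    have "h (f q) = (SUP s\<in>f ` S. dist (f q) s)"
      unfolding h_def \<open>f ` S = S\<close> ..
    also have "\<dots> = h q"
      unfolding h_def by (simp add: image_image f)
    finally show "f q = q"
      by (rule unique)
  qed
qed

text \<open>Going from the nearest point \<open>c\<close> of \<open>F\<close> through \<open>x\<close> and beyond, the distance to \<open>F\<close> keeps
  growing at unit speed, so a point outside of \<open>F\<close> leads to points far away from \<open>F\<close>.\<close>

lemma geodesically_complete_ball_subset: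
  fixes F :: "'a::metric_space set"
  assumes proper: "proper_metric_space TYPE('a)" and CAT0: "CAT0 TYPE('a)"
    and complete: "geodesically_complete TYPE('a)"
    and F: "closed F" "F \<noteq> {}"
    and convex: "\<And>c p q t. p \<in> F \<Longrightarrow> q \<in> F \<Longrightarrow> geodesic_between c p q \<Longrightarrow> t \<in> {0..dist p q} \<Longrightarrow> c t \<in> F"
    and near: "\<And>y. y \<in> cball a (R + 1) \<Longrightarrow> \<exists>q\<in>F. dist y q < 1"
  shows "cball a R \<subseteq> F"
proof (rule subsetI, rule ccontr)
  fix x assume x: "x \<in> cball a R" "x \<notin> F"
  obtain c where c: "c \<in> F" "\<forall>y\<in>F. dist x c \<le> dist x y"
    by (rule proper_nearest_point_exists[OF proper F])
  define d where "d = dist c x"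
  have d: "d > 0"
    using x c by (auto simp: d_def)
  obtain g where g: "geodesic_between g c x"
    by (rule CAT0_geodesic_exists[OF CAT0])
  obtain L where L: "geodesic_line L" "\<forall>t\<in>{0..d}. L t = g t"
    using complete g d unfolding geodesically_complete_def d_def by (metis zero_less_dist_iff)
  have L0: "L 0 = c" and Ld: "L d = x"
    using L(2) g d by (auto simp: geodesic_between_def d_def)
  \<comment> \<open>One unit beyond \<open>x\<close>, so \<open>y\<close> is still in the ball of
    radius \<open>R + 1\<close>, where \<open>near\<close> applies.\<close>
  define y where "y = L (d + 1)"
  have L_dist: "dist (L s) (L t) = \<bar>s - t\<bar>" for s t
    using L(1) by (simp add: geodesic_line_def)
  have cy: "dist c y = d + 1"
    using L_dist[of 0 "d + 1"] d by (simp add: L0 y_def)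
  have Lcy: "geodesic_between L c y"
    unfolding geodesic_between_def cy using L0 L_dist by (simp add: y_def)
  have "dist x y = 1"
    using L_dist[of d "d + 1"] by (simp add: Ld y_def)
  then have "y \<in> cball a (R + 1)"
    using x dist_triangle[of a y x] by simp
  then obtain q where q: "q \<in> F" "dist y q < 1"
    using near by blast
  obtain e where e: "geodesic_between e c q"
    by (rule CAT0_geodesic_exists[OF CAT0])
  \<comment> \<open>Contraction towards \<open>c\<close> by this ratio carries \<open>y\<close> back
    to \<open>x\<close>, and \<open>q\<close> to a point of \<open>F\<close> at distance less than
    \<open>l\<close> \<le> \<open>d\<close> from \<open>x\<close>.\<close>
  define l where "l = d / (d + 1)"
  have l: "0 < l" "l \<le> 1" "l \<le> d" "l * (d + 1) = d"
    using d by (auto simp: l_def field_simps)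
  have "e (l * dist c q) \<in> F"
    using l by (intro convex[OF c(1) q(1) e]) (simp add: mult_left_le_one_le)
  then have "d \<le> dist x (e (l * dist c q))"
    using c by (auto simp: d_def dist_commute)
  also have "\<dots> \<le> l * dist y q"
    using CAT0_hinge[OF CAT0 Lcy e, of l] l by (simp add: cy Ld)
  also have "\<dots> < l * 1"
    using l q by (intro mult_strict_left_mono) auto
  finally show False
    using l by simp
qed

subsection \<open>Small open subgroups\<close>

lemma (in topological_group) continuous_map_translation:
  assumes "a \<in> carrier G"
  shows "continuous_map T T (\<lambda>g. a \<otimes> g)"
proof -
  have "continuous_map T (prod_topology T T) (\<lambda>g. (a, g))"
    using assms by (auto simp: continuous_map_pairedI topspace_eq)
  from continuous_map_compose[OF this continuous_mult] show ?thesis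
    by (simp add: o_def)
qed

text \<open>Van Dantzig's theorem: a compact open neighbourhood \<open>A\<close> of the identity is stable under
  right multiplication by all elements close to the identity, and its right stabilizer is contained
  in \<open>A\<close>.\<close>

lemma (in locally_compact_group) small_subgroup_exists:
  assumes "totally_disconnected_space T" "openin T W" "\<one> \<in> W"
  obtains U V where "subgroup U G" "U \<subseteq> W" "openin T V" "\<one> \<in> V" "V \<subseteq> U"
proof -
  have one: "\<one> \<in> topspace T"
    by (simp add: topspace_eq)
  obtain O' N where N: "openin T O'" "compactin T N" "\<one> \<in> O'" "O' \<subseteq> N"
    using locally_compact one unfolding locally_compact_space_def by blast
  have "connected_component_of_set T \<one> = {\<one>}"
  proof -
    obtain a where "connected_component_of_set T \<one> \<subseteq> {a}"
      using assms(1) connectedin_connected_component_of unfolding totally_disconnected_space_def by metis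
    moreover have "\<one> \<in> connected_component_of_set T \<one>"
      using one by (simp add: connected_component_of_refl)
    ultimately show ?thesis
      by auto
  qed
  then have "{\<one>} \<in> connected_components_of T"
    using one by (metis connected_component_in_connected_components_of)
  moreover have "compactin T {\<one>}" "openin T (W \<inter> O')" "{\<one>} \<subseteq> W \<inter> O'"
    using one N assms by auto
  \<comment> \<open>The compact component of the identity lies in the open set
    \<open>W \<inter> O'\<close>, hence in a clopen \<open>A\<close> inside that set. Being
    contained in \<open>N\<close>, \<open>A\<close> is compact.\<close>
  ultimately obtain A B where AB: "openin T A" "openin T B" "disjnt A B" "A \<union> B = topspace T"
      "{\<one>} \<subseteq> A" "A \<subseteq> W \<inter> O'"
    using wilder_locally_compact_component_thm[OF locally_compact Hausdorff] by metis
  then have "A = topspace T - B"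
    by (auto simp: disjnt_iff)
  then have "compactin T A"
    using AB N by (intro closed_compactin[OF N(2)]) auto
  have A_carrier: "A \<subseteq> carrier G"
    using AB(4) by (auto simp: topspace_eq)
  \<comment> \<open>The tube lemma, applied to \<open>A \<times> {\<one>}\<close> inside this
    preimage of \<open>A\<close>, gives one \<open>V\<close> that works for all
    \<open>a \<in> A\<close>.\<close>
  define W' where "W' = {x \<in> topspace (prod_topology T T). (\<lambda>(g, h). g \<otimes> h) x \<in> A}"
  have "openin (prod_topology T T) W'"
    unfolding W'_def by (rule openin_continuous_map_preimage[OF continuous_mult AB(1)])
  moreover have "A \<times> {\<one>} \<subseteq> W'"
    using A_carrier by (auto simp: W'_def topspace_eq)
  ultimately obtain A' V where V: "openin T A'" "openin T V" "A \<subseteq> A'" "{\<one>} \<subseteq> V" "A' \<times> V \<subseteq> W'"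
    using Wallace_theorem_prod_topology[OF \<open>compactin T A\<close> \<open>compactin T {\<one>}\<close>] by metis
  have stable: "a \<otimes> v \<in> A" if "a \<in> A" "v \<in> V" for a v
  proof -
    have "(a, v) \<in> W'"
      using that V by auto
    then show ?thesis
      by (simp add: W'_def)
  qed
  \<comment> \<open>Treating \<open>g\<close> and \<open>inv g\<close> alike makes the right
    stabilizer a group; accordingly \<open>V'\<close> is a symmetrized \<open>V\<close>.\<close>
  define U where "U = {g \<in> carrier G. (\<forall>a\<in>A. a \<otimes> g \<in> A) \<and> (\<forall>a\<in>A. a \<otimes> inv g \<in> A)}"
  define V' where "V' = V \<inter> {g \<in> topspace T. inv g \<in> V}"
  show thesis
  proof (rule that)
    show "subgroup U G"
    proof
      show "U \<subseteq> carrier G"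
        by (auto simp: U_def)
      show "\<one> \<in> U"
        using A_carrier by (auto simp: U_def)
      show "inv g \<in> U" if "g \<in> U" for g
        using that by (auto simp: U_def)
      show "g \<otimes> h \<in> U" if "g \<in> U" "h \<in> U" for g h
        using that A_carrier by (auto simp: U_def inv_mult_group subset_iff simp flip: m_assoc)
    qed
    show "U \<subseteq> W"
    proof
      fix g assume "g \<in> U"
      then have "\<one> \<otimes> g \<in> A" "g \<in> carrier G"
        using AB by (auto simp: U_def)
      then show "g \<in> W"
        using AB by auto
    qed
    show "openin T V'"
      unfolding V'_def using V(2) openin_continuous_map_preimage[OF continuous_inv V(2)] by auto
    show "\<one> \<in> V'"
      using V(4) one by (auto simp: V'_def)
    show "V' \<subseteq> U"
      using stable by (auto simp: V'_def U_def topspace_eq)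
  qed
qed

subsection \<open>Isometric actions\<close>

lemma isometric_actionD:
  assumes "isometric_action G \<phi>"
  shows "group_action G UNIV \<phi>"
    and "g \<in> carrier G \<Longrightarrow> dist (\<phi> g x) (\<phi> g y) = dist x y"
  using assms by (auto simp: isometric_action_def)

lemma isometric_action_mult:
  assumes "isometric_action G \<phi>" "g \<in> carrier G" "h \<in> carrier G"
  shows "\<phi> (g \<otimes>\<^bsub>G\<^esub> h) x = \<phi> g (\<phi> h x)"
  using group_action.composition_rule[OF isometric_actionD(1)[OF assms(1)]] assms(2,3) by simp

lemma isometric_action_one:
  assumes "isometric_action G \<phi>"
  shows "\<phi> \<one>\<^bsub>G\<^esub> x = x"
  using group_action.id_eq_one[OF isometric_actionD(1)[OF assms]] by (metis restrict_UNIV)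

lemma isometric_action_inv:
  assumes "isometric_action G \<phi>" "g \<in> carrier G"
  shows "\<phi> (inv\<^bsub>G\<^esub> g) (\<phi> g x) = x" "\<phi> g (\<phi> (inv\<^bsub>G\<^esub> g) x) = x"
proof -
  interpret group_action G UNIV \<phi>
    using isometric_actionD(1)[OF assms(1)] .
  interpret group G
    using group_hom by (simp add: group_hom_def)
  show "\<phi> (inv\<^bsub>G\<^esub> g) (\<phi> g x) = x" "\<phi> g (\<phi> (inv\<^bsub>G\<^esub> g) x) = x"
    using assms isometric_action_mult[OF assms(1), symmetric] isometric_action_one[OF assms(1)]
    by simp_all
qed

lemma isometric_action_pow:
  assumes "isometric_action G \<phi>" "g \<in> carrier G"
  shows "\<phi> (g [^]\<^bsub>G\<^esub> (n::nat)) x = (\<phi> g ^^ n) x"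
proof -
  interpret group_action G UNIV \<phi>
    using isometric_actionD(1)[OF assms(1)] .
  interpret group G
    using group_hom by (simp add: group_hom_def)
  show ?thesis
    using assms by (induction n arbitrary: x)
      (simp_all add: isometric_action_one isometric_action_mult funpow_swap1)
qed

section \<open>Pointwise fixed balls and uniform local order\<close>

lemma continuous_action_almost_fixing_nbhd:
  fixes G (structure) and \<phi> :: "'g \<Rightarrow> 'x::metric_space \<Rightarrow> 'x"
  assumes "topological_group G T"
    and isom: "isometric_action G \<phi>" and cont: "continuous_action T \<phi>" and "compact S"
  obtains W where "openin T W" "\<one> \<in> W" "\<And>g y. g \<in> W \<Longrightarrow> y \<in> S \<Longrightarrow> dist (\<phi> g y) y < 3 / 4"
proof -
  interpret topological_group G T by fact
  \<comment> \<open>An isometry moving a centre by less than 1/4 moves each point of the 1/4-ball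
    about it by less than 3/4, so finitely many centres control all of \<open>S\<close>.\<close>
  have "S \<subseteq> (\<Union>p\<in>S. ball p (1 / 4))"
    by force
  then obtain D where D: "D \<subseteq> S" "finite D" "S \<subseteq> (\<Union>p\<in>D. ball p (1 / 4))"
    by (rule compactE_image[OF \<open>compact S\<close> open_ball])
  \<comment> \<open>Intersecting with \<open>topspace T\<close> covers the case of empty
    \<open>D\<close>.\<close>
  define W where "W = (\<Inter>p\<in>D. {g \<in> topspace T. \<phi> g p \<in> ball p (1 / 4)}) \<inter> topspace T"
  have "openin T {g \<in> topspace T. \<phi> g p \<in> ball p (1 / 4)}" for p
  proof (rule openin_continuous_map_preimage)
    have "continuous_map T (prod_topology T euclidean) (\<lambda>g. (g, p))"
      by (intro continuous_map_pairedI) auto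
    from continuous_map_compose[OF this cont[unfolded continuous_action_def]]
    show "continuous_map T euclidean (\<lambda>g. \<phi> g p)"
      by (simp add: o_def)
  qed simp
  then have W: "openin T W"
    unfolding W_def using D(2) by (intro openin_INT) auto
  show thesis
  proof (rule that[OF W])
    show "\<one> \<in> W"
      by (simp add: W_def topspace_eq isometric_action_one[OF isom])
    fix g y assume "g \<in> W" "y \<in> S"
    then obtain p where p: "p \<in> D" "dist p y < 1 / 4"
      using D by auto
    then have "g \<in> carrier G" "dist p (\<phi> g p) < 1 / 4"
      using \<open>g \<in> W\<close> by (auto simp: W_def topspace_eq)
    moreover have "dist (\<phi> g p) (\<phi> g y) = dist p y"
      using isometric_actionD(2)[OF isom \<open>g \<in> carrier G\<close>] .
    ultimately have "dist (\<phi> g y) y < 1 / 4 + 1 / 4 + 1 / 4"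
      using p dist_triangle[of "\<phi> g y" y "\<phi> g p"] dist_triangle[of "\<phi> g p" y p]
      by (simp add: dist_commute)
    then show "dist (\<phi> g y) y < 3 / 4"
      by simp
  qed
qed

text \<open>A small subgroup \<open>U\<close> moves the points of a large ball very little. The circumcenters of its
  orbits are \<open>U\<close>-fixed points close to all points of that ball.\<close>

lemma ball_fixing_nbhd:
  fixes G (structure) and \<phi> :: "'g \<Rightarrow> 'x::metric_space \<Rightarrow> 'x"
  assumes "locally_compact_group G T" and "totally_disconnected_space T"
    and proper: "proper_metric_space TYPE('x)" and CAT0: "CAT0 TYPE('x)"
    and complete: "geodesically_complete TYPE('x)"
    and isom: "isometric_action G \<phi>" and cont: "continuous_action T \<phi>"
  obtains V where "openin T V" "\<one> \<in> V" "\<And>v x. v \<in> V \<Longrightarrow> x \<in> cball a R \<Longrightarrow> \<phi> v x = x"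
proof -
  interpret locally_compact_group G T by fact
  have compact: "compact (cball a (R + 1))"
    using proper by (simp add: proper_metric_space_def)
  obtain W where W: "openin T W" "\<one> \<in> W"
      "\<And>g y. g \<in> W \<Longrightarrow> y \<in> cball a (R + 1) \<Longrightarrow> dist (\<phi> g y) y < 3 / 4"
    using continuous_action_almost_fixing_nbhd[OF topological_group_axioms isom cont compact] by metis
  obtain U V where UV: "subgroup U G" "U \<subseteq> W" "openin T V" "\<one> \<in> V" "V \<subseteq> U"
    by (rule small_subgroup_exists[OF assms(2) W(1,2)])
  interpret U: subgroup U G by fact
  note dist_action = isometric_actionD(2)[OF isom]
  define F where "F = {x. \<forall>u\<in>U. \<phi> u x = x}"
  have near: "\<exists>q\<in>F. dist y q < 1" if y: "y \<in> cball a (R + 1)" for y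
  proof -
    define S where "S = (\<lambda>u. \<phi> u y) ` U"
    have "y \<in> S"
      using U.one_closed isometric_action_one[OF isom, of y] unfolding S_def by (metis imageI)
    moreover have "S \<subseteq> cball y (3 / 4)"
      using W(3)[OF _ y] UV(2) by (force simp: S_def dist_commute)
    \<comment> \<open>The radius 3/4 of the orbit leaves room for the strict bound 1 required of
      \<open>q\<close>.\<close>
    ultimately obtain q where q: "dist y q \<le> 3 / 4"
        "\<And>f. (\<And>u v. dist (f u) (f v) = dist u v) \<Longrightarrow> f ` S = S \<Longrightarrow> f q = q"
      using CAT0_circumcenter[OF proper CAT0] by metis
    have "\<phi> u q = q" if u: "u \<in> U" for u
    proof (rule q(2))
      show "dist (\<phi> u v) (\<phi> u w) = dist v w" for v w
        using u dist_action by simp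
      have sub: "\<phi> u ` S \<subseteq> S" if "u \<in> U" for u
        using that isometric_action_mult[OF isom, symmetric] by (auto simp: S_def)
      show "\<phi> u ` S = S"
      proof (intro equalityI subsetI)
        fix s assume "s \<in> S"
        then have "\<phi> (inv u) s \<in> S"
          using sub[of "inv u"] u by auto
        then show "s \<in> \<phi> u ` S"
          using isometric_action_inv(2)[OF isom, of u s] u by (metis U.mem_carrier imageI)
      qed (use sub[OF u] in blast)
    qed
    then show ?thesis
      using q(1) by (intro bexI[of _ q]) (auto simp: F_def)
  qed
  have "F = (\<Inter>u\<in>U. {x. \<phi> u x = x})"
    by (auto simp: F_def)
  moreover have "closed {x. \<phi> u x = x}" if "u \<in> U" for u
  proof (rule closed_Collect_eq)
    show "continuous_on UNIV (\<phi> u)"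
      using dist_action[of u] that by (auto simp: continuous_on_iff)
  qed simp
  ultimately have closed: "closed F"
    by auto
  have convex: "c t \<in> F"
    if "p \<in> F" "q \<in> F" "geodesic_between c p q" "t \<in> {0..dist p q}" for c p q t
    using that CAT0_geodesic_between_fixed_points[OF CAT0 _ that(3) _ _ that(4)] dist_action
    by (auto simp: F_def)
  have "\<phi> v x = x" if "v \<in> V" "x \<in> cball a R" for v x
  proof -
    \<comment> \<open>A point of \<open>cball a R\<close> forces \<open>R\<close> \<ge> 0, so
      \<open>near\<close> applies to the centre and shows that \<open>F\<close> is nonempty.\<close>
    have "a \<in> cball a (R + 1)"
      using that(2) zero_le_dist[of a x] by (simp del: zero_le_dist)
    then have "F \<noteq> {}"
      using near by blast
    have "cball a R \<subseteq> F"
      by (rule geodesically_complete_ball_subset[OF proper CAT0 complete closed \<open>F \<noteq> {}\<close>])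
        (fact convex near)+
    then have "x \<in> F"
      using that(2) by blast
    then show ?thesis
      using UV(5) that(1) by (auto simp: F_def)
  qed
  then show thesis
    using that UV(3,4) by blast
qed

text \<open>By cocompactness, \<open>g\<close> has a conjugate with a fixed point in
  \<open>K\<close>. Its powers lie in the compact set \<open>C\<close>, whose elements have only
  finitely many restrictions to a ball containing the unit neighbourhood of \<open>K\<close>. So two
  powers agree there, and their quotient acts trivially.\<close>

lemma elliptic_uniform_local_order:
  fixes G (structure) and \<phi> :: "'g \<Rightarrow> 'x::metric_space \<Rightarrow> 'x"
  assumes "locally_compact_group G T" and "totally_disconnected_space T"
    and "proper_metric_space TYPE('x)" and "CAT0 TYPE('x)"
    and "geodesically_complete TYPE('x)"
    and isom: "isometric_action G \<phi>" and "continuous_action T \<phi>"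
    and "proper_action G T \<phi>" and "cocompact_action G \<phi>"
  obtains N :: nat
  where "\<And>g p. g \<in> carrier G \<Longrightarrow> \<phi> g p = p \<Longrightarrow>
           \<exists>n\<in>{1..N}. \<forall>x\<in>cball p 1. (\<phi> g ^^ n) x = x"
proof -
  interpret locally_compact_group G T by fact
  note dist_action = isometric_actionD(2)[OF isom]
  note action_mult = isometric_action_mult[OF isom]
  note action_inv = isometric_action_inv[OF isom]
  obtain K where K: "compact K" "(\<Union>g\<in>carrier G. \<phi> g ` K) = UNIV"
    using assms(9) by (auto simp: cocompact_action_def)
  obtain a r where r: "K \<subseteq> cball a r"
    using compact_imp_bounded[OF K(1)] by (meson bounded_subset_cball)
  \<comment> \<open>The radius \<open>r + 1\<close> makes \<open>V\<close> fix the unit balls about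
    all points of \<open>K\<close>.\<close>
  obtain V where V: "openin T V" "\<one> \<in> V" "\<And>v x. v \<in> V \<Longrightarrow> x \<in> cball a (r + 1) \<Longrightarrow> \<phi> v x = x"
    using ball_fixing_nbhd[OF assms(1-7)] by metis
  define C where "C = {g \<in> carrier G. \<phi> g ` K \<inter> K \<noteq> {}}"
  \<comment> \<open>This is the left translate of \<open>V\<close> by \<open>f\<close>; its elements
    act like \<open>f\<close> on \<open>cball a (r + 1)\<close>.\<close>
  define nbhd where "nbhd f = {h \<in> topspace T. inv f \<otimes> h \<in> V}" for f
  have "compactin T C"
    using assms(8) K(1) by (simp add: proper_action_def C_def)
  moreover have "openin T (nbhd f)" if "f \<in> C" for f
    unfolding nbhd_def using that V(1)
    by (intro openin_continuous_map_preimage[OF continuous_map_translation]) (auto simp: C_def)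
  moreover have "f \<in> nbhd f" if "f \<in> C" for f
    using that V(2) by (auto simp: nbhd_def C_def topspace_eq)
  ultimately obtain \<F> where "finite \<F>" "\<F> \<subseteq> nbhd ` C" "C \<subseteq> \<Union>\<F>"
    using compactinD[of T C "nbhd ` C"] by blast
  then obtain D where D: "D \<subseteq> C" "finite D" "C \<subseteq> (\<Union>f\<in>D. nbhd f)"
    by (metis finite_subset_image)
  have nbhd: "\<phi> h x = \<phi> f x" if "f \<in> D" "h \<in> nbhd f" "x \<in> cball a (r + 1)" for f h x
  proof -
    have "f \<in> carrier G" "h \<in> carrier G" "inv f \<otimes> h \<in> V"
      using that D(1) by (auto simp: nbhd_def C_def topspace_eq)
    then show ?thesis
      using V(3)[OF _ that(3), of "inv f \<otimes> h"] action_mult[of "inv f" h x] action_inv(2)[of f "\<phi> h x"]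
      by simp
  qed
  show thesis
  proof (rule that[of "card D"])
    fix g p assume g: "g \<in> carrier G" and p: "\<phi> g p = p"
    obtain h k where h: "h \<in> carrier G" "k \<in> K" "p = \<phi> h k"
      using K(2) by blast
    \<comment> \<open>The conjugated powers fix \<open>k \<in> K\<close> and therefore belong to
      \<open>C\<close>.\<close>
    define c where "c i = inv h \<otimes> (g [^] i \<otimes> h)" for i :: nat
    have c: "c i \<in> carrier G" "\<phi> (c i) x = \<phi> (inv h) ((\<phi> g ^^ i) (\<phi> h x))" for i x
    proof -
      have "inv h \<in> carrier G" "g [^] i \<in> carrier G"
        using g h by simp_all
      then show "c i \<in> carrier G" "\<phi> (c i) x = \<phi> (inv h) ((\<phi> g ^^ i) (\<phi> h x))"
        unfolding c_def isometric_action_pow[OF isom g, symmetric]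
        using h(1) by (simp_all only: action_mult m_closed)
    qed
    have "(\<phi> g ^^ i) p = p" for i
      using p by (induction i) auto
    then have "\<phi> (c i) k = k" for i
      using h action_inv(1)[of h k] by (simp only: c)
    then have "k \<in> \<phi> (c i) ` K \<inter> K" for i
      using h(2) by (intro IntI image_eqI[of _ _ k]) simp_all
    then have "c i \<in> C" for i
      using c(1) unfolding C_def by blast
    then have "\<exists>f\<in>D. c i \<in> nbhd f" for i
      using D(3) by blast
    then obtain b where b: "\<And>i. b i \<in> D" "\<And>i. c i \<in> nbhd (b i)"
      by metis
    \<comment> \<open>Pigeonhole: the \<open>card D + 1\<close> exponents from 0 to
      \<open>card D\<close> are assigned elements of \<open>D\<close>.\<close>
    have "card (b ` {..card D}) \<le> card D"
      using b(1) D(2) by (intro card_mono) auto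
    then have "\<not> inj_on b {..card D}"
      by (intro pigeonhole) simp
    then obtain i j where ij: "i < j" "j \<le> card D" "b i = b j"
      unfolding inj_on_def by (metis atMost_iff linorder_neqE_nat)
    have "(\<phi> g ^^ (j - i)) x = x" if x: "x \<in> cball p 1" for x
    proof -
      let ?y = "\<phi> (inv h) x"
      have y: "\<phi> h ?y = x"
        using h by (simp add: action_inv)
      then have "dist k ?y \<le> 1"
        using x h dist_action[of h k ?y] by simp
      then have "?y \<in> cball a (r + 1)"
        using r h(2) dist_triangle[of a ?y k] by force
      then have "\<phi> (c i) ?y = \<phi> (c j) ?y"
        using nbhd b ij(3) by metis
      then have "\<phi> h (\<phi> (inv h) ((\<phi> g ^^ i) x)) = \<phi> h (\<phi> (inv h) ((\<phi> g ^^ j) x))"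
        by (simp only: c y)
      then have "(\<phi> g ^^ i) x = (\<phi> g ^^ (i + (j - i))) x"
        using h ij(1) by (simp add: action_inv)
      then have "(\<phi> g ^^ i) x = (\<phi> g ^^ i) ((\<phi> g ^^ (j - i)) x)"
        by (simp only: funpow_add o_apply)
      \<comment> \<open>Injectivity cancels the \<open>i\<close>-th iterate and leaves the power
        \<open>j - i\<close>.\<close>
      moreover have "inj (\<phi> g)"
        using action_inv(1)[OF g] by (metis injI)
      ultimately show ?thesis
        by (metis inj_fn injD)
    qed
    moreover have "j - i \<in> {1..card D}"
      using ij by auto
    ultimately show "\<exists>n\<in>{1..card D}. \<forall>x\<in>cball p 1. (\<phi> g ^^ n) x = x"
      by blast
  qed
qed

subsection \<open>Alexandrov angles\<close>

text \<open>The squared triangle inequalities keep the argument of \<open>arccos\<close> in the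
  range where it inverts the cosine.\<close>

lemma comparison_angle_cos_bounds:
  fixes p x y :: "'a::metric_space"
  assumes "x \<noteq> p" "y \<noteq> p"
  shows "- 1 \<le> ((dist p x)\<^sup>2 + (dist p y)\<^sup>2 - (dist x y)\<^sup>2) / (2 * dist p x * dist p y)"
    and "((dist p x)\<^sup>2 + (dist p y)\<^sup>2 - (dist x y)\<^sup>2) / (2 * dist p x * dist p y) \<le> 1"
proof -
  have "\<bar>dist p x - dist p y\<bar> \<le> dist x y" "dist x y \<le> dist p x + dist p y"
    by metric+
  then have "(dist p x - dist p y)\<^sup>2 \<le> (dist x y)\<^sup>2" "(dist x y)\<^sup>2 \<le> (dist p x + dist p y)\<^sup>2"
    by (auto simp: abs_le_square_iff[symmetric])
  then have le: "(dist p x)\<^sup>2 + (dist p y)\<^sup>2 - (dist x y)\<^sup>2 \<le> 1 * (2 * dist p x * dist p y)"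
    and ge: "- 1 * (2 * dist p x * dist p y) \<le> (dist p x)\<^sup>2 + (dist p y)\<^sup>2 - (dist x y)\<^sup>2"
    unfolding power2_sum power2_diff by linarith+
  have pos: "0 < 2 * dist p x * dist p y"
    using assms by simp
  show "- 1 \<le> ((dist p x)\<^sup>2 + (dist p y)\<^sup>2 - (dist x y)\<^sup>2) / (2 * dist p x * dist p y)"
    using pos_le_divide_eq[OF pos] ge by blast
  show "((dist p x)\<^sup>2 + (dist p y)\<^sup>2 - (dist x y)\<^sup>2) / (2 * dist p x * dist p y) \<le> 1"
    using pos_divide_le_eq[OF pos] le by blast
qed

text \<open>The base of the isosceles comparison triangle is a chord of a circle of radius
  \<open>t\<close>, no longer than its arc, which is less than \<open>e * t\<close>.\<close>

lemma dist_less_of_comparison_angle_less: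
  fixes p x y :: "'a::metric_space"
  assumes "dist p x = t" "dist p y = t" "t > 0" "comparison_angle p x y < e" "e \<le> pi"
  shows "dist x y < e * t"
proof -
  define v where "v = ((dist p x)\<^sup>2 + (dist p y)\<^sup>2 - (dist x y)\<^sup>2) / (2 * dist p x * dist p y)"
  have "x \<noteq> p" "y \<noteq> p"
    using assms by auto
  then have v: "- 1 \<le> v" "v \<le> 1"
    unfolding v_def using comparison_angle_cos_bounds by blast+
  have angle: "arccos v < e"
    using assms(4) by (simp add: comparison_angle_def v_def)
  have e: "0 < e"
    using arccos_lbound[OF v] angle by simp
  \<comment> \<open>This gives \<open>1 - e\<^sup>2 / 2\<close> \<le> \<open>cos e\<close>; as
    \<open>e\<close> \<le> \<open>pi\<close>, the cosine is decreasing on the relevant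
    range.\<close>
  have "(sin (e / 2))\<^sup>2 \<le> (e / 2)\<^sup>2"
    using abs_sin_x_le_abs_x by (simp only: abs_le_square_iff)
  then have "1 - e\<^sup>2 / 2 \<le> 1 - 2 * (sin (e / 2))\<^sup>2"
    by (simp add: power_divide)
  also have "\<dots> = cos e"
    using cos_double_sin[of "e / 2"] by simp
  also have "\<dots> < cos (arccos v)"
    using arccos_lbound[OF v] angle assms(5) by (intro cos_monotone_0_pi) auto
  also have "\<dots> = v"
    using v by (rule cos_arccos)
  also have "v = 1 - (dist x y)\<^sup>2 / (2 * t\<^sup>2)"
    using assms(1-3) by (simp add: v_def power2_eq_square field_simps)
  finally have "(dist x y)\<^sup>2 < (e * t)\<^sup>2"
    using assms(3) by (simp add: field_simps)
  then show ?thesis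
    by (rule power2_less_imp_less) (use e assms(3) in simp)
qed

text \<open>By uniqueness, the geodesic to \<open>f x\<close> is the image of the one to
  \<open>x\<close>, so its point at parameter \<open>t\<close> is \<open>f z\<close> for the point
  \<open>z\<close> at \<open>t\<close> on the other. A small comparison angle at \<open>t\<close>
  bounds the displacement of \<open>z\<close>.\<close>

lemma small_Alexandrov_angle_displacement:
  fixes f :: "'a::metric_space \<Rightarrow> 'a"
  assumes CAT0: "CAT0 TYPE('a)" and f: "\<And>u v. dist (f u) (f v) = dist u v"
    and p: "f p = p" "x \<noteq> p"
    and angle: "Alexandrov_angle p (f x) x < e" "e \<le> pi" and "d > 0"
  obtains t z where "0 < t" "t \<le> d" "dist p z = t" "dist z x = dist p x - t" "dist (f z) z < e * t"
proof -
  define b where "b = (SOME c. geodesic_between c p (f x))"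
  define c where "c = (SOME c. geodesic_between c p x)"
  have b: "geodesic_between b p (f x)"
    unfolding b_def using CAT0_geodesic_exists[OF CAT0] by (metis someI_ex)
  have c: "geodesic_between c p x"
    unfolding c_def using CAT0_geodesic_exists[OF CAT0] by (metis someI_ex)
  have px: "dist p (f x) = dist p x"
    using f[of p x] p by simp
  have bc: "b t = f (c t)" if "t \<in> {0..dist p x}" for t
    using CAT0_geodesic_unique[OF CAT0 b, of "f \<circ> c" t] geodesic_between_image[OF c f] that p px
    by simp
  have b0: "b 0 = p"
    using b by (simp add: geodesic_between_def)
  define F where "F = (\<lambda>(t, t'). ereal (comparison_angle p (b t) (c t')))"
  define P where "P t \<longleftrightarrow> 0 < t \<and> t \<le> dist p x \<and> t \<le> d" for t
  have P: "eventually P (at_right 0)"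
    unfolding eventually_at_right_field P_def
    using p(2) \<open>d > 0\<close> by (intro exI[of _ "min (dist p x) d"]) auto
  have distP: "dist p (b t) = t" "dist p (c t) = t" if "P t" for t
    using that geodesic_between_dist(1)[OF b, of t] geodesic_between_dist(1)[OF c, of t]
    by (auto simp: P_def px)
  \<comment> \<open>The bound excludes an infinite upper limit, which \<open>real_of_ereal\<close>
    would turn into 0.\<close>
  have "eventually (\<lambda>x. F x \<le> ereal pi) (at_right 0 \<times>\<^sub>F at_right 0)"
    unfolding eventually_prod_filter
  proof (intro exI conjI allI impI)
    fix t t' assume "P t" "P t'"
    then have "b t \<noteq> p" "c t' \<noteq> p"
      using distP[of t] distP[of t'] by (auto simp: P_def)
    then show "F (t, t') \<le> ereal pi"
      using arccos_ubound[OF comparison_angle_cos_bounds]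
      by (simp add: F_def comparison_angle_def)
  qed (fact P)+
  then have "Limsup (at_right 0 \<times>\<^sub>F at_right 0) F \<le> ereal pi"
    by (rule Limsup_bounded)
  moreover have "real_of_ereal (Limsup (at_right 0 \<times>\<^sub>F at_right 0) F) < e"
    using angle(1) unfolding Alexandrov_angle_def Alexandrov_angle_geodesics_def
      b_def[symmetric] c_def[symmetric] b0 F_def .
  ultimately have "Limsup (at_right 0 \<times>\<^sub>F at_right 0) F < ereal e"
    by (cases "Limsup (at_right 0 \<times>\<^sub>F at_right 0) F") auto
  then have "eventually (\<lambda>x. F x < ereal e) (at_right 0 \<times>\<^sub>F at_right 0)"
    by (rule Limsup_lessD)
  then obtain Q Q' where Q: "eventually Q (at_right 0)" "eventually Q' (at_right 0)"
      "\<And>t t'. Q t \<Longrightarrow> Q' t' \<Longrightarrow> F (t, t') < ereal e"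
    unfolding eventually_prod_filter by blast
  \<comment> \<open>Taking both parameters equal makes the comparison triangle isosceles.\<close>
  have "eventually (\<lambda>t. P t \<and> Q t \<and> Q' t) (at_right 0)"
    using P Q(1,2) by (intro eventually_conj)
  then obtain t where t: "P t" "Q t" "Q' t"
    using eventually_happens'[OF trivial_limit_at_right_real] by blast
  have "comparison_angle p (b t) (c t) < e"
    using Q(3)[OF t(2,3)] by (simp add: F_def)
  then have "dist (b t) (c t) < e * t"
    using distP[OF t(1)] t(1) angle(2) by (intro dist_less_of_comparison_angle_less) (auto simp: P_def)
  then show thesis
    using t(1) bc[of t] geodesic_between_dist[OF c, of t]
    by (intro that[of t "c t"]) (auto simp: P_def)
qed

text \<open>Consecutive orbit points are \<open>dist (f z) z\<close> apart, and periodicity reduces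
  exponents modulo \<open>n\<close>. So the orbit lies in the stated ball about \<open>z\<close>,
  and its circumcenter is the required \<open>q\<close>.\<close>

lemma fixed_point_near_periodic_point:
  fixes f :: "'a::metric_space \<Rightarrow> 'a"
  assumes proper: "proper_metric_space TYPE('a)" and CAT0: "CAT0 TYPE('a)"
    and f: "\<And>u v. dist (f u) (f v) = dist u v"
    and n: "(f ^^ n) z = z" "1 \<le> n" "n \<le> N"
  obtains q where "f q = q" "dist z q \<le> real N * dist (f z) z"
proof -
  define S where "S = range (\<lambda>i. (f ^^ i) z)"
  have iter: "dist z ((f ^^ i) z) \<le> real i * dist (f z) z" for i
  proof (induction i)
    case (Suc i)
    have "dist z ((f ^^ Suc i) z) \<le> dist z (f z) + dist (f z) (f ((f ^^ i) z))"
      by (simp add: dist_triangle)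
    also have "\<dots> \<le> dist z (f z) + real i * dist (f z) z"
      using Suc f by simp
    finally show ?case
      by (simp add: algebra_simps dist_commute)
  qed simp
  have "dist z ((f ^^ i) z) \<le> real N * dist (f z) z" for i
  proof -
    have "dist z ((f ^^ i) z) \<le> real (i mod n) * dist (f z) z"
      using iter[of "i mod n"] funpow_mod_eq[OF n(1), of i] by simp
    also have "\<dots> \<le> real N * dist (f z) z"
      using n by (intro mult_right_mono) (auto intro: order_trans[OF less_imp_le[OF mod_less_divisor]])
    finally show ?thesis .
  qed
  then have "S \<subseteq> cball z (real N * dist (f z) z)"
    by (auto simp: S_def)
  moreover have "z \<in> S"
    unfolding S_def by (rule image_eqI[of _ _ 0]) simp_all
  ultimately obtain q where q: "dist z q \<le> real N * dist (f z) z"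
      "\<And>g. (\<And>u v. dist (g u) (g v) = dist u v) \<Longrightarrow> g ` S = S \<Longrightarrow> g q = q"
    using CAT0_circumcenter[OF proper CAT0] by metis
  have "f ` S = S"
  proof (intro equalityI subsetI)
    fix s assume "s \<in> f ` S"
    then obtain i where "s = f ((f ^^ i) z)"
      unfolding S_def by blast
    then have "s = (f ^^ Suc i) z"
      by simp
    then show "s \<in> S"
      unfolding S_def by blast
  next
    fix s assume "s \<in> S"
    then obtain i where "s = (f ^^ i) z"
      unfolding S_def by blast
    \<comment> \<open>A full period makes the exponent positive, so that one application of
      \<open>f\<close> can be split off.\<close>
    also have "\<dots> = (f ^^ (i + n)) z"
      by (simp add: funpow_add n(1))
    also have "i + n = Suc (i + (n - 1))"
      using n(2) by simp
    finally have "s = f ((f ^^ (i + (n - 1))) z)"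
      by simp
    then show "s \<in> f ` S"
      unfolding S_def by blast
  qed
  then show thesis
    using that q f by blast
qed

theorem proposition6p8:
  fixes G :: "('g, 'r) monoid_scheme" and T :: "'g topology"
    and \<phi> :: "'g \<Rightarrow> 'x::metric_space \<Rightarrow> 'x"
  assumes "locally_compact_group G T"
    and "totally_disconnected_space T"
    and "proper_metric_space TYPE('x)"
    and "CAT0 TYPE('x)"
    and "geodesically_complete TYPE('x)"
    and "isometric_action G \<phi>"
    and "continuous_action T \<phi>"
    and "proper_action G T \<phi>"
    and "cocompact_action G \<phi>"
  shows "\<exists>\<epsilon>>0. \<forall>g\<in>carrier G. elliptic (\<phi> g) \<longrightarrow>
           (\<forall>x. \<phi> g x \<noteq> x \<longrightarrow>
              Alexandrov_angle (nearest_point (fixed_points (\<phi> g)) x) (\<phi> g x) x \<ge> \<epsilon>)"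
proof -
  obtain N :: nat where N: "\<And>g p. g \<in> carrier G \<Longrightarrow> \<phi> g p = p \<Longrightarrow>
      \<exists>n\<in>{1..N}. \<forall>x\<in>cball p 1. (\<phi> g ^^ n) x = x"
    using elliptic_uniform_local_order[OF assms] by metis
  \<comment> \<open>The choice makes \<open>N * e\<close> < 1, so the fixed point found near
    \<open>z\<close> is at distance less than \<open>t\<close> from it.\<close>
  define e where "e = 1 / (real N + 1)"
  have e: "0 < e" "e \<le> 1" "real N * e < 1"
    by (simp_all add: e_def divide_le_eq)
  have e_pi: "e \<le> pi"
    using e(2) pi_gt3 by linarith
  have "e \<le> Alexandrov_angle (nearest_point (fixed_points (\<phi> g)) x) (\<phi> g x) x"
    if g: "g \<in> carrier G" "elliptic (\<phi> g)" and x: "\<phi> g x \<noteq> x" for g x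
  proof (rule ccontr)
    let ?p = "nearest_point (fixed_points (\<phi> g)) x"
    assume "\<not> ?thesis"
    then have small: "Alexandrov_angle ?p (\<phi> g x) x < e"
      by simp
    note isom = isometric_actionD(2)[OF assms(6) g(1)]
    note p = nearest_point_fixed_points[where f = "\<phi> g" and x = x, OF assms(3,4) isom g(2)]
    have "x \<noteq> ?p"
      using p(1) x by metis
    \<comment> \<open>The bound \<open>t\<close> \<le> 1 keeps \<open>z\<close> in the unit ball
      about \<open>?p\<close>, on which some power of \<open>g\<close> is trivial.\<close>
    then obtain t z where t: "0 < t" "t \<le> 1" "dist ?p z = t" "dist z x = dist ?p x - t"
        "dist (\<phi> g z) z < e * t"
      using small_Alexandrov_angle_displacement[OF assms(4) isom p(1) _ small e_pi, of 1] by auto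
    obtain n where n: "1 \<le> n" "n \<le> N" "(\<phi> g ^^ n) z = z"
      using N[OF g(1) p(1)] t(2,3) by auto
    obtain q where q: "\<phi> g q = q" "dist z q \<le> real N * dist (\<phi> g z) z"
      by (rule fixed_point_near_periodic_point[OF assms(3,4) isom n(3,1,2)])
    note q(2)
    also have "real N * dist (\<phi> g z) z \<le> real N * (e * t)"
      using t(5) by (intro mult_left_mono) auto
    also have "\<dots> < t"
      using e(3) t(1) mult_strict_right_mono[of "real N * e" 1 t] by (simp add: mult.assoc)
    \<comment> \<open>Passing from \<open>?p\<close> to \<open>z\<close> gains exactly
      \<open>t\<close>, and passing on to \<open>q\<close> loses less than \<open>t\<close>.\<close>
    finally have "dist x q < dist x ?p"
      using t(4) dist_triangle[of x q z] by (simp add: dist_commute)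
    then show False
      using p(2)[OF q(1)] by simp
  qed
  then show ?thesis
    using e(1) by blast
qed

end
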